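(* Let $n\ge 1$. There is a natural bijection between the set $H^0(\widehat{X}_{W(\widetilde{A}_n)})$ of irreducible components of the Shi variety $\widehat{X}_{W(\widetilde{A}_n)}$ and the set of circular permutations of $W(A_n)=S_{n+1}$. Here "natural" means that the bijection $\Psi$ from circular permutations to components respects the actions of $W(A_n)$, i.e. $\Psi(\sigma c\sigma^{-1})=\sigma\diamond\Psi(c)$ for all $\sigma\in W(A_n)$ and all circular permutations $c$. In particular $|H^0(\widehat{X}_{W(\widetilde{A}_n)})|=n!$.
   Context: Let $W(A_n)=S_{n+1}$; a circular permutation is an $(n+1)$-cycle in $S_{n+1}$, and $W(A_n)$ acts on circular permutations by conjugation. Let $m=n(n+1)/2$ and index the coordinates of $\mathbb{R}^m$ by pairs $(i,j)$ with $1\le i<j\le n+1$ (the pair $(i,j)$ corresponds to the positive root $e_i-e_j$ of type $A_n$). An admitted vector is a vector of integers $\lambda=(\lambda_{i,j})_{1\le i<j\le n+1}$ such that $\lambda_{i,i+1}=0$ for all $1\le i\le n$ and $\lambda_{i,j}+\lambda_{j,k}\le\lambda_{i,k}\le\lambda_{i,j}+\lambda_{j,k}+1$ for all $1\le i<j<k\le n+1$. For an admitted vector $\lambda$, let $X_{W(\widetilde{A}_n)}[\lambda]=\{x\in\mathbb{R}^m : x_{i,j}=\sum_{r=i}^{j-1}x_{r,r+1}+\lambda_{i,j}\text{ for all }1\le i<j\le n+1\}$. The Shi variety is $\widehat{X}_{W(\widetilde{A}_n)}=\bigsqcup_{\lambda\text{ admitted}}X_{W(\widetilde{A}_n)}[\lambda]\subset\mathbb{R}^m$,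 and its set of irreducible components is $H^0(\widehat{X}_{W(\widetilde{A}_n)})=\{X_{W(\widetilde{A}_n)}[\lambda] : \lambda\text{ admitted}\}$. The $\Phi^+$-representation (restricted to $W(A_n)$) is the homomorphism $F:W(A_n)\to\mathrm{Isom}(\mathbb{R}^m)$ given by: for $w\in S_{n+1}$, $x\in\mathbb{R}^m$ and $i<j$, $F(w)(x)_{i,j}=x_{w^{-1}(i),w^{-1}(j)}$ if $w^{-1}(i)<w^{-1}(j)$, and $F(w)(x)_{i,j}=-x_{w^{-1}(j),w^{-1}(i)}-1$ if $w^{-1}(i)>w^{-1}(j)$. It is known that each $F(w)$ permutes the sets $X_{W(\widetilde{A}_n)}[\lambda]$, $\lambda$ admitted; this gives the action $w\diamond X_{W(\widetilde{A}_n)}[\lambda]:=F(w)(X_{W(\widetilde{A}_n)}[\lambda])$ of $W(A_n)$ on $H^0(\widehat{X}_{W(\widetilde{A}_n)})$. *)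

theory Defs
  imports Complex_Main "HOL-Library.FuncSet" "HOL-Combinatorics.Cycles"
    "HOL-Computational_Algebra.Polynomial"
begin

section \<open>The symmetric group and circular permutations\<close>

definition W_A :: "nat \<Rightarrow> (nat \<Rightarrow> nat) set" where
  "W_A n = {w. w permutes {1..n + 1}}"

definition circular_perms :: "nat \<Rightarrow> (nat \<Rightarrow> nat) set" where
  "circular_perms n =
     {c \<in> W_A n. \<exists>cs. cycle cs \<and> set cs \<subseteq> {1..n + 1} \<and> length cs = n + 1 \<and> c = cycle_of_list cs}"


section \<open>Irreducible components of real algebraic sets\<close>

text \<open>
  For a finite set \<open>I\<close>, affine space with coordinates indexed by \<open>I\<close> is the set
  \<open>extensional I\<close> of functions \<open>'i \<Rightarrow> real\<close> which are undefined outside \<open>I\<close>.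
\<close>

inductive_set poly_functions :: "'i set \<Rightarrow> (('i \<Rightarrow> real) \<Rightarrow> real) set" for I where
  const: "(\<lambda>_. c) \<in> poly_functions I"
| coord: "i \<in> I \<Longrightarrow> (\<lambda>x. x i) \<in> poly_functions I"
| add: "p \<in> poly_functions I \<Longrightarrow> q \<in> poly_functions I \<Longrightarrow> (\<lambda>x. p x + q x) \<in> poly_functions I"
| mult: "p \<in> poly_functions I \<Longrightarrow> q \<in> poly_functions I \<Longrightarrow> (\<lambda>x. p x * q x) \<in> poly_functions I"

definition algebraic_set :: "'i set \<Rightarrow> ('i \<Rightarrow> real) set \<Rightarrow> bool" where
  "algebraic_set I Z \<longleftrightarrow>
     (\<exists>P \<subseteq> poly_functions I. Z = {x \<in> extensional I. \<forall>p\<in>P. p x = 0})"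

text \<open>Irreducibility and components refer to the Zariski topology, whose closed sets are the
  algebraic sets.\<close>

definition irreducible_set :: "'i set \<Rightarrow> ('i \<Rightarrow> real) set \<Rightarrow> bool" where
  "irreducible_set I Z \<longleftrightarrow> Z \<noteq> {} \<and> Z \<subseteq> extensional I \<and>
     (\<forall>A B. algebraic_set I A \<longrightarrow> algebraic_set I B \<longrightarrow> Z \<subseteq> A \<union> B \<longrightarrow> Z \<subseteq> A \<or> Z \<subseteq> B)"

definition irreducible_components :: "'i set \<Rightarrow> ('i \<Rightarrow> real) set \<Rightarrow> ('i \<Rightarrow> real) set set" where
  "irreducible_components I V =
     {Z. Z \<subseteq> V \<and> irreducible_set I Z \<and>
         (\<forall>Z'. Z \<subseteq> Z' \<longrightarrow> Z' \<subseteq> V \<longrightarrow> irreducible_set I Z' \<longrightarrow> Z' = Z)}"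


section \<open>The Shi variety\<close>

definition pos_roots :: "nat \<Rightarrow> (nat \<times> nat) set" where
  "pos_roots n = {(i, j). 1 \<le> i \<and> i < j \<and> j \<le> n + 1}"

definition admitted :: "nat \<Rightarrow> (nat \<times> nat \<Rightarrow> int) set" where
  "admitted n = {lam \<in> extensional (pos_roots n).
     (\<forall>i\<in>{1..n}. lam (i, i + 1) = 0) \<and>
     (\<forall>i j k. 1 \<le> i \<and> i < j \<and> j < k \<and> k \<le> n + 1 \<longrightarrow>
        lam (i, j) + lam (j, k) \<le> lam (i, k) \<and> lam (i, k) \<le> lam (i, j) + lam (j, k) + 1)}"

definition X_comp :: "nat \<Rightarrow> (nat \<times> nat \<Rightarrow> int) \<Rightarrow> (nat \<times> nat \<Rightarrow> real) set" where
  "X_comp n lam = {x \<in> extensional (pos_roots n).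
     \<forall>(i, j) \<in> pos_roots n. x (i, j) = (\<Sum>r = i..j - 1. x (r, r + 1)) + of_int (lam (i, j))}"

definition shi_variety :: "nat \<Rightarrow> (nat \<times> nat \<Rightarrow> real) set" where
  "shi_variety n = (\<Union>lam\<in>admitted n. X_comp n lam)"

definition H0_shi :: "nat \<Rightarrow> (nat \<times> nat \<Rightarrow> real) set set" where
  "H0_shi n = irreducible_components (pos_roots n) (shi_variety n)"

definition Phi_rep :: "nat \<Rightarrow> (nat \<Rightarrow> nat) \<Rightarrow> (nat \<times> nat \<Rightarrow> real) \<Rightarrow> (nat \<times> nat \<Rightarrow> real)" where
  "Phi_rep n w x = (\<lambda>(i, j) \<in> pos_roots n.
     if inv w i < inv w j then x (inv w i, inv w j) else - x (inv w j, inv w i) - 1)"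

definition diamond ::
  "nat \<Rightarrow> (nat \<Rightarrow> nat) \<Rightarrow> (nat \<times> nat \<Rightarrow> real) set \<Rightarrow> (nat \<times> nat \<Rightarrow> real) set" where
  "diamond n w X = Phi_rep n w ` X"


section \<open>The components of the Shi variety are the sets \<open>X_comp n lam\<close>\<close>

lemma poly_functions_sum:
  assumes "finite R" "\<And>r. r \<in> R \<Longrightarrow> f r \<in> poly_functions I"
  shows "(\<lambda>x. \<Sum>r\<in>R. f r x) \<in> poly_functions I"
  using assms
proof (induction R rule: finite_induct)
  case empty
  show ?case using poly_functions.const[of 0 I] by simp
next
  case (insert r R)
  then show ?case using poly_functions.add[of "f r" I "\<lambda>x. \<Sum>r\<in>R. f r x"] by simp
qed

lemma algebraic_Un:
  assumes "algebraic_set I A" "algebraic_set I B"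
  shows "algebraic_set I (A \<union> B)"
proof -
  obtain P where P: "P \<subseteq> poly_functions I" "A = {x \<in> extensional I. \<forall>p\<in>P. p x = 0}"
    using assms(1) unfolding algebraic_set_def by blast
  obtain Q where Q: "Q \<subseteq> poly_functions I" "B = {x \<in> extensional I. \<forall>p\<in>Q. p x = 0}"
    using assms(2) unfolding algebraic_set_def by blast
  let ?R = "{(\<lambda>x. p x * q x) | p q. p \<in> P \<and> q \<in> Q}"
  have "?R \<subseteq> poly_functions I" using P(1) Q(1) by (auto intro: poly_functions.mult)
  moreover have "A \<union> B = {x \<in> extensional I. \<forall>p\<in>?R. p x = 0}" (is "_ = ?Z")
  proof
    show "A \<union> B \<subseteq> ?Z" unfolding P Q by auto
    show "?Z \<subseteq> A \<union> B"
    proof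
      fix x assume x: "x \<in> ?Z"
      show "x \<in> A \<union> B"
      proof (rule ccontr)
        assume "x \<notin> A \<union> B"
        then obtain p q where pq: "p \<in> P" "p x \<noteq> 0" "q \<in> Q" "q x \<noteq> 0"
          using x unfolding P Q by blast
        have "(\<lambda>x. p x * q x) \<in> ?R" using pq by blast
        moreover have "\<And>f. f \<in> ?R \<Longrightarrow> f x = 0" using x by simp
        ultimately have "p x * q x = 0" by fast
        then show False using pq by simp
      qed
    qed
  qed
  ultimately show ?thesis unfolding algebraic_set_def by blast
qed

lemma algebraic_empty: "algebraic_set I {}"
  unfolding algebraic_set_def
  by (rule exI[of _ "{\<lambda>_. 1}"]) (auto intro: poly_functions.const)

lemma algebraic_Union:
  assumes "finite F" "\<And>A. A \<in> F \<Longrightarrow> algebraic_set I A"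
  shows "algebraic_set I (\<Union>F)"
  using assms by (induction F rule: finite_induct) (auto simp: algebraic_empty algebraic_Un)

lemma irreducible_subset_Union:
  assumes "finite F" "\<And>A. A \<in> F \<Longrightarrow> algebraic_set I A" "irreducible_set I Z" "Z \<subseteq> \<Union>F"
  shows "\<exists>A\<in>F. Z \<subseteq> A"
  using assms
proof (induction F rule: finite_induct)
  case empty
  then show ?case by (auto simp: irreducible_set_def)
next
  case (insert A F)
  have "algebraic_set I (\<Union>F)" using insert by (intro algebraic_Union) auto
  moreover have "algebraic_set I A" "Z \<subseteq> A \<union> \<Union>F" using insert by auto
  ultimately have "Z \<subseteq> A \<or> Z \<subseteq> \<Union>F"
    using insert.prems(2) unfolding irreducible_set_def by blast
  then show ?case using insert by auto
qed

definition line :: "'i set \<Rightarrow> ('i \<Rightarrow> real) \<Rightarrow> ('i \<Rightarrow> real) \<Rightarrow> real \<Rightarrow> 'i \<Rightarrow> real" where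
  "line I a b t = (\<lambda>i\<in>I. a i + t * (b i - a i))"

lemma line_ends: "a \<in> extensional I \<Longrightarrow> line I a b 0 = a" "b \<in> extensional I \<Longrightarrow> line I a b 1 = b"
  by (auto simp: line_def extensional_def restrict_def)

lemma poly_function_on_line:
  assumes "p \<in> poly_functions I"
  shows "\<exists>q :: real poly. \<forall>t. p (line I a b t) = poly q t"
  using assms
proof induction
  case (const c)
  show ?case by (rule exI[of _ "[:c:]"]) simp
next
  case (coord i)
  then show ?case
    by (intro exI[of _ "[:a i, b i - a i:]"]) (simp add: line_def)
next
  case (add p q)
  then show ?case by (metis poly_add)
next
  case (mult p q)
  then show ?case by (metis poly_mult)
qed

lemma irreducible_if_closed_under_lines:
  assumes "Z \<noteq> {}" "Z \<subseteq> extensional I"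
    and lines: "\<And>a b t. a \<in> Z \<Longrightarrow> b \<in> Z \<Longrightarrow> line I a b t \<in> Z"
  shows "irreducible_set I Z"
  unfolding irreducible_set_def
proof (intro conjI allI impI)
  fix A B assume A: "algebraic_set I A" and B: "algebraic_set I B" and Z: "Z \<subseteq> A \<union> B"
  show "Z \<subseteq> A \<or> Z \<subseteq> B"
  proof (rule ccontr)
    assume "\<not> (Z \<subseteq> A \<or> Z \<subseteq> B)"
    then obtain a b where ab: "a \<in> Z" "a \<notin> A" "b \<in> Z" "b \<notin> B" by blast
    obtain p where p: "p \<in> poly_functions I" "p a \<noteq> 0" "\<And>x. x \<in> A \<Longrightarrow> p x = 0"
      using A ab assms(2) unfolding algebraic_set_def by blast
    obtain q where q: "q \<in> poly_functions I" "q b \<noteq> 0" "\<And>x. x \<in> B \<Longrightarrow> q x = 0"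
      using B ab assms(2) unfolding algebraic_set_def by blast
    obtain p' where p': "\<And>t. p (line I a b t) = poly p' t"
      using poly_function_on_line[OF p(1)] by blast
    obtain q' where q': "\<And>t. q (line I a b t) = poly q' t"
      using poly_function_on_line[OF q(1)] by blast
    have "poly p' 0 \<noteq> 0" "poly q' 1 \<noteq> 0"
      using p(2) q(2) ab assms(2) p'[of 0] q'[of 1] by (auto simp: line_ends subset_iff)
    then have "p' * q' \<noteq> 0" by auto
    moreover have "poly (p' * q') t = 0" for t
    proof -
      have "line I a b t \<in> A \<union> B" using lines ab Z by blast
      then show ?thesis using p(3) q(3) p' q' by (metis UnE mult_eq_0_iff poly_mult)
    qed
    then have "p' * q' = 0" using poly_all_0_iff_0 by blast
    ultimately show False by contradiction
  qed
qed (use assms in auto)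

lemma simple_in_pos_roots:
  assumes "(i, j) \<in> pos_roots n" "r \<in> {i..j - 1}"
  shows "(r, Suc r) \<in> pos_roots n"
  using assms by (auto simp: pos_roots_def)

lemma X_comp_algebraic: "algebraic_set (pos_roots n) (X_comp n lam)"
proof -
  let ?I = "pos_roots n"
  let ?p = "\<lambda>(i, j) x. x (i, j) + ((- 1) * (\<Sum>r = i..j - 1. x (r, r + 1)) + (- of_int (lam (i, j))) :: real)"
  have "?p a \<in> poly_functions ?I" if "a \<in> ?I" for a
  proof -
    obtain i j where a: "a = (i, j)" by fastforce
    have "(\<lambda>x. \<Sum>r = i..j - 1. x (r, r + 1)) \<in> poly_functions ?I"
      using that unfolding a
      by (intro poly_functions_sum poly_functions.coord) (auto dest: simple_in_pos_roots)
    then show ?thesis unfolding a prod.case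
      using that a by (intro poly_functions.intros) auto
  qed
  then have "?p ` ?I \<subseteq> poly_functions ?I" by blast
  moreover have "X_comp n lam = {x \<in> extensional ?I. \<forall>p\<in>?p ` ?I. p x = 0}"
    by (auto simp: X_comp_def split_beta)
  ultimately show ?thesis unfolding algebraic_set_def by blast
qed

lemma admitted_diag:
  assumes "lam \<in> admitted n" "1 \<le> r" "r \<le> n"
  shows "lam (r, Suc r) = 0"
  using assms by (auto simp: admitted_def)

lemma X_comp_nonempty:
  assumes "lam \<in> admitted n"
  shows "X_comp n lam \<noteq> {}"
proof -
  have "(\<lambda>a\<in>pos_roots n. real_of_int (lam a)) \<in> X_comp n lam"
    unfolding X_comp_def
  proof (safe, goal_cases)
    case (2 i j)
    have "(\<Sum>r = i..j - 1. restrict (\<lambda>a. real_of_int (lam a)) (pos_roots n) (r, r + 1)) = 0"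
      using 2 by (intro sum.neutral) (auto simp: admitted_diag[OF assms] pos_roots_def)
    then show ?case using 2 by simp
  qed auto
  then show ?thesis by blast
qed

lemma X_comp_irreducible:
  assumes "lam \<in> admitted n"
  shows "irreducible_set (pos_roots n) (X_comp n lam)"
proof (rule irreducible_if_closed_under_lines)
  fix a b t assume a: "a \<in> X_comp n lam" and b: "b \<in> X_comp n lam"
  let ?l = "line (pos_roots n) a b t"
  have "?l (i, j) = (\<Sum>r = i..j - 1. ?l (r, r + 1)) + of_int (lam (i, j))"
    if ij: "(i, j) \<in> pos_roots n" for i j
  proof -
    have "(\<Sum>r = i..j - 1. ?l (r, r + 1)) = (\<Sum>r = i..j - 1. a (r, r + 1) + t * (b (r, r + 1) - a (r, r + 1)))"
      using simple_in_pos_roots[OF ij] by (intro sum.cong) (auto simp: line_def)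
    also have "\<dots> = (\<Sum>r = i..j - 1. a (r, r + 1)) +
        t * ((\<Sum>r = i..j - 1. b (r, r + 1)) - (\<Sum>r = i..j - 1. a (r, r + 1)))"
      by (simp add: sum.distrib sum_subtractf sum_distrib_left[symmetric])
    also have "\<dots> = (a (i, j) - lam (i, j)) + t * (b (i, j) - a (i, j))"
    proof -
      have "a (i, j) = (\<Sum>r = i..j - 1. a (r, r + 1)) + of_int (lam (i, j))"
        "b (i, j) = (\<Sum>r = i..j - 1. b (r, r + 1)) + of_int (lam (i, j))"
        using a b ij unfolding X_comp_def by auto
      then show ?thesis by simp
    qed
    finally show ?thesis using ij by (simp add: line_def)
  qed
  then show "?l \<in> X_comp n lam" by (auto simp: X_comp_def line_def)
qed (use X_comp_nonempty[OF assms] in \<open>auto simp: X_comp_def\<close>)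

lemma X_comp_disjoint:
  assumes "lam \<in> admitted n" "mu \<in> admitted n" "x \<in> X_comp n lam" "x \<in> X_comp n mu"
  shows "lam = mu"
proof (rule extensionalityI[of _ "pos_roots n"])
  fix a assume "a \<in> pos_roots n"
  then show "lam a = mu a"
    using assms(3,4) by (cases a) (fastforce simp: X_comp_def)
qed (use assms(1,2) in \<open>auto simp: admitted_def\<close>)

lemma finite_pos_roots: "finite (pos_roots n)"
  by (rule finite_subset[of _ "{..n + 1} \<times> {..n + 1}"]) (auto simp: pos_roots_def)

lemma admitted_bounds:
  assumes "lam \<in> admitted n" "1 \<le> i" "i + d + 1 \<le> n + 1"
  shows "0 \<le> lam (i, i + d + 1) \<and> lam (i, i + d + 1) \<le> int d"
  using assms(3)
proof (induction d)
  case 0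
  then show ?case using admitted_diag[of lam n i] assms by simp
next
  case (Suc d)
  let ?j = "i + d + 1"
  have "lam (i, ?j) + lam (?j, Suc ?j) \<le> lam (i, Suc ?j) \<and> lam (i, Suc ?j) \<le> lam (i, ?j) + lam (?j, Suc ?j) + 1"
  proof -
    have "1 \<le> i \<and> i < ?j \<and> ?j < Suc ?j \<and> Suc ?j \<le> n + 1"
      using assms(2) Suc.prems by simp
    then show ?thesis using assms(1) unfolding admitted_def by blast
  qed
  moreover have "lam (?j, Suc ?j) = 0" using admitted_diag[OF assms(1)] Suc.prems by simp
  ultimately show ?case using Suc by auto
qed

lemma finite_admitted: "finite (admitted n)"
proof (rule finite_subset)
  show "finite (pos_roots n \<rightarrow>\<^sub>E {0..int n})" by (intro finite_PiE finite_pos_roots) auto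
  show "admitted n \<subseteq> pos_roots n \<rightarrow>\<^sub>E {0..int n}"
  proof
    fix lam assume l: "lam \<in> admitted n"
    have "lam a \<in> {0..int n}" if aI: "a \<in> pos_roots n" for a
    proof -
      obtain i j where a: "a = (i, j)" "1 \<le> i" "i < j" "j \<le> n + 1"
        using aI by (cases a) (auto simp: pos_roots_def)
      then show ?thesis using admitted_bounds[OF l, of i "j - i - 1"] by auto
    qed
    moreover have "lam \<in> extensional (pos_roots n)" using l by (simp add: admitted_def)
    ultimately show "lam \<in> pos_roots n \<rightarrow>\<^sub>E {0..int n}" by (auto simp: PiE_iff)
  qed
qed

theorem H0_shi_eq: "H0_shi n = X_comp n ` admitted n"
proof -
  let ?I = "pos_roots n"
  have in_one: "\<exists>lam\<in>admitted n. Z \<subseteq> X_comp n lam"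
    if "irreducible_set ?I Z" "Z \<subseteq> shi_variety n" for Z
  proof -
    have "\<exists>A\<in>X_comp n ` admitted n. Z \<subseteq> A"
      using that by (intro irreducible_subset_Union[of _ ?I])
        (auto simp: finite_admitted X_comp_algebraic shi_variety_def)
    then show ?thesis by blast
  qed
  have sub: "X_comp n lam \<subseteq> shi_variety n" if "lam \<in> admitted n" for lam
    using that by (auto simp: shi_variety_def)
  show ?thesis
  proof (intro equalityI subsetI)
    fix Z assume "Z \<in> H0_shi n"
    then have Z: "Z \<subseteq> shi_variety n" "irreducible_set ?I Z"
      "\<And>Z'. Z \<subseteq> Z' \<Longrightarrow> Z' \<subseteq> shi_variety n \<Longrightarrow> irreducible_set ?I Z' \<Longrightarrow> Z' = Z"
      unfolding H0_shi_def irreducible_components_def by blast+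
    obtain lam where "lam \<in> admitted n" "Z \<subseteq> X_comp n lam" using in_one Z by blast
    then show "Z \<in> X_comp n ` admitted n" using Z(3) X_comp_irreducible sub by blast
  next
    fix Z assume "Z \<in> X_comp n ` admitted n"
    then obtain lam where l: "lam \<in> admitted n" "Z = X_comp n lam" by blast
    have "Z' = Z" if Z': "Z \<subseteq> Z'" "Z' \<subseteq> shi_variety n" "irreducible_set ?I Z'" for Z'
    proof -
      obtain mu where m: "mu \<in> admitted n" "Z' \<subseteq> X_comp n mu" using in_one Z' by blast
      obtain x where "x \<in> Z" using X_comp_nonempty l by blast
      then have "lam = mu" using X_comp_disjoint l m Z'(1) by blast
      then show ?thesis using l m Z'(1) by blast
    qed
    then show "Z \<in> H0_shi n"
      unfolding H0_shi_def irreducible_components_def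
      using l X_comp_irreducible sub by blast
  qed
qed

end

theory Submission
  imports Defs
begin

text \<open>
  Extend \<open>x\<close> to all pairs \<open>i \<noteq> j\<close> by \<open>x\<^sub>i\<^sub>j + x\<^sub>j\<^sub>i = - 1\<close>. Then \<open>w\<close> acts by mere
  permutation of indices, and two points lie in the same component iff their extensions differ by a
  coboundary \<open>f j - f i\<close>. For admitted \<open>\<lambda>\<close> the sum \<open>\<lambda>\<^sub>i\<^sub>j + \<lambda>\<^sub>j\<^sub>k + \<lambda>\<^sub>k\<^sub>i\<close>, which is invariant under
  coboundaries, is \<open>- 1\<close> or \<open>- 2\<close>; it thus encodes a cyclic order on the indices. Cutting this order
  at the index 1 yields a unique \<open>w\<close> fixing 1 with \<open>X[\<lambda>] = w \<diamond> X[0]\<close>. Likewise every circular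
  permutation is \<open>w c w\<^sup>-\<^sup>1\<close> for a unique \<open>w\<close> fixing 1, where \<open>c = (1 2 \<dots> n+1)\<close>. As \<open>c\<close> stabilises
  \<open>X[0]\<close> and any permutation becomes one fixing 1 after multiplication by a power of \<open>c\<close> on the right,
  matching the two parametrisations gives an equivariant bijection.
\<close>

section \<open>The \<open>\<Phi>\<^sup>+\<close>-representation in signed coordinates\<close>

text \<open>Polymorphic so as to serve both real points and integer vectors. The diagonal values
  carry no meaning, hence the conditions \<open>i \<noteq> j\<close> below.\<close>

definition signed_coord :: "(nat \<times> nat \<Rightarrow> 'a::ring_1) \<Rightarrow> nat \<Rightarrow> nat \<Rightarrow> 'a" where
  "signed_coord x i j = (if i < j then x (i, j) else - x (j, i) - 1)"

lemma signed_coord_swap: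
  "i \<noteq> j \<Longrightarrow> signed_coord x i j + signed_coord x j i = - 1"
  by (auto simp: signed_coord_def)

lemma extensional_eq_signed_coord:
  assumes "x \<in> extensional (pos_roots n)" "y \<in> extensional (pos_roots n)"
    and "\<And>i j. i \<in> {1..n + 1} \<Longrightarrow> j \<in> {1..n + 1} \<Longrightarrow> i \<noteq> j \<Longrightarrow> signed_coord x i j = signed_coord y i j"
  shows "x = y"
proof (rule extensionalityI[OF assms(1,2)])
  fix a assume "a \<in> pos_roots n"
  then show "x a = y a"
    using assms(3)[of "fst a" "snd a"] by (auto simp: pos_roots_def signed_coord_def)
qed

lemma W_A_in_iff:
  assumes "w \<in> W_A n"
  shows "w i \<in> {1..n + 1} \<longleftrightarrow> i \<in> {1..n + 1}" "inv w i \<in> {1..n + 1} \<longleftrightarrow> i \<in> {1..n + 1}"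
  using assms permutes_in_image[of w "{1..n + 1}"] permutes_in_image[OF permutes_inv, of w "{1..n + 1}"]
  by (simp_all only: W_A_def mem_Collect_eq)

lemma W_A_inv_apply:
  assumes "w \<in> W_A n"
  shows "w (inv w i) = i" "inv w (w i) = i" "inv w i = inv w j \<longleftrightarrow> i = j" "w i = w j \<longleftrightarrow> i = j"
proof -
  have w: "w permutes {1..n + 1}" using assms by (simp add: W_A_def)
  show inverses: "w (inv w i) = i" "inv w (w i) = i" for i
    by (simp_all add: permutes_inverses[OF w])
  show "inv w i = inv w j \<longleftrightarrow> i = j" "w i = w j \<longleftrightarrow> i = j"
    using inverses by metis+
qed

lemma W_A_comp: "v \<in> W_A n \<Longrightarrow> w \<in> W_A n \<Longrightarrow> v \<circ> w \<in> W_A n"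
  by (simp add: W_A_def permutes_compose)

lemma W_A_inv: "w \<in> W_A n \<Longrightarrow> inv w \<in> W_A n"
  by (simp add: W_A_def permutes_inv)

lemma W_A_bij: "w \<in> W_A n \<Longrightarrow> bij w"
  by (simp add: W_A_def permutes_bij)

lemma Phi_rep_extensional: "Phi_rep n w x \<in> extensional (pos_roots n)"
  by (simp add: Phi_rep_def)

text \<open>\<open>Phi_rep\<close> and \<open>signed_coord\<close> follow the same sign rule, and
  \<open>x \<mapsto> - x - 1\<close> is an involution, so only the substitution of indices
  remains.\<close>

lemma signed_coord_Phi_rep:
  assumes "w \<in> W_A n" "i \<in> {1..n + 1}" "j \<in> {1..n + 1}" "i \<noteq> j"
  shows "signed_coord (Phi_rep n w x) i j = signed_coord x (inv w i) (inv w j)"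
proof -
  have "inv w i \<noteq> inv w j" using assms by (simp add: W_A_inv_apply)
  then show ?thesis
    using assms by (auto simp: signed_coord_def Phi_rep_def pos_roots_def)
qed

lemma Phi_rep_comp:
  assumes "v \<in> W_A n" "w \<in> W_A n"
  shows "Phi_rep n (v \<circ> w) x = Phi_rep n v (Phi_rep n w x)"
proof (rule extensional_eq_signed_coord[OF Phi_rep_extensional Phi_rep_extensional])
  fix i j assume ij: "i \<in> {1..n + 1}" "j \<in> {1..n + 1}" "i \<noteq> j"
  have "inv (v \<circ> w) = inv w \<circ> inv v"
    using assms by (simp add: o_inv_distrib W_A_bij)
  moreover have "inv v i \<in> {1..n + 1}" "inv v j \<in> {1..n + 1}" "inv v i \<noteq> inv v j"
    using assms ij by (simp_all only: W_A_in_iff W_A_inv_apply not_False_eq_True)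
  ultimately show "signed_coord (Phi_rep n (v \<circ> w) x) i j
      = signed_coord (Phi_rep n v (Phi_rep n w x)) i j"
    using assms ij by (simp only: signed_coord_Phi_rep W_A_comp o_apply not_False_eq_True)
qed

lemma diamond_comp:
  assumes "v \<in> W_A n" "w \<in> W_A n"
  shows "diamond n (v \<circ> w) X = diamond n v (diamond n w X)"
  using assms by (simp add: diamond_def image_image Phi_rep_comp)

lemma Phi_rep_inv:
  assumes "w \<in> W_A n" "x \<in> extensional (pos_roots n)"
  shows "Phi_rep n w (Phi_rep n (inv w) x) = x"
proof (rule extensional_eq_signed_coord[OF Phi_rep_extensional assms(2)])
  fix i j assume ij: "i \<in> {1..n + 1}" "j \<in> {1..n + 1}" "i \<noteq> j"
  moreover have "inv w i \<in> {1..n + 1}" "inv w j \<in> {1..n + 1}" "inv w i \<noteq> inv w j"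
    using assms ij by (simp_all only: W_A_in_iff W_A_inv_apply not_False_eq_True)
  ultimately show "signed_coord (Phi_rep n w (Phi_rep n (inv w) x)) i j = signed_coord x i j"
    using assms by (simp only: signed_coord_Phi_rep W_A_inv inv_inv_eq W_A_bij W_A_inv_apply not_False_eq_True)
qed


section \<open>Components modulo coboundaries\<close>

text \<open>The potential \<open>f\<close> collects partial sums of simple coordinates; conversely
  the sums telescope because \<open>lam\<close> vanishes on simple roots. Coboundaries are
  antisymmetric, so both sides obey the same swap rule and reversed pairs follow.\<close>

lemma X_comp_iff:
  assumes "lam \<in> admitted n"
  shows "x \<in> X_comp n lam \<longleftrightarrow> x \<in> extensional (pos_roots n) \<and>
    (\<exists>f. \<forall>i\<in>{1..n + 1}. \<forall>j\<in>{1..n + 1}. i \<noteq> j \<longrightarrow>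
       signed_coord x i j = f j - f i + of_int (signed_coord lam i j))"
    (is "_ \<longleftrightarrow> _ \<and> (\<exists>f. ?cob f)")
proof safe
  assume x: "x \<in> X_comp n lam"
  then show "x \<in> extensional (pos_roots n)" by (simp add: X_comp_def)
  define f where "f j = (\<Sum>r = 1..<j. x (r, Suc r))" for j
  have pos: "x (i, j) = f j - f i + of_int (lam (i, j))" if "(i, j) \<in> pos_roots n" for i j
  proof -
    have "{i..j - 1} = {i..<j}" "1 \<le> i" "i \<le> j"
      using that by (auto simp: pos_roots_def)
    then have "f j = f i + (\<Sum>r = i..j - 1. x (r, Suc r))"
      by (simp add: f_def sum.atLeastLessThan_concat)
    moreover have "x (i, j) = (\<Sum>r = i..j - 1. x (r, Suc r)) + of_int (lam (i, j))"
      using x that unfolding X_comp_def by auto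
    ultimately show ?thesis by simp
  qed
  have "?cob f"
    using pos by (auto simp: signed_coord_def pos_roots_def)
  then show "\<exists>f. ?cob f" by blast
next
  fix f assume x: "x \<in> extensional (pos_roots n)" and f: "?cob f"
  have pos: "x (i, j) = f j - f i + of_int (lam (i, j))" if "(i, j) \<in> pos_roots n" for i j
    using bspec[OF bspec[OF f, of i], of j] that by (simp add: pos_roots_def signed_coord_def)
  have "x (i, j) = (\<Sum>r = i..j - 1. x (r, r + 1)) + of_int (lam (i, j))"
    if ij: "(i, j) \<in> pos_roots n" for i j
  proof -
    have "(\<Sum>r = i..j - 1. x (r, r + 1)) = (\<Sum>r = i..<j. f (Suc r) - f r)"
      using ij pos admitted_diag[OF assms] by (intro sum.cong) (auto simp: pos_roots_def)
    also have "\<dots> = f j - f i"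
      using ij by (intro sum_Suc_diff') (auto simp: pos_roots_def)
    finally show ?thesis using pos[OF ij] by simp
  qed
  then show "x \<in> X_comp n lam" using x by (auto simp: X_comp_def)
qed

text \<open>Reduces an equality of components to the integer vectors: a coboundary between
  \<open>mu\<close> and the transported \<open>lam\<close> is absorbed into the potential of
  \<open>X_comp_iff\<close>, subtracted in one direction and added in the other.\<close>

lemma diamond_X_comp_eqI:
  assumes "lam \<in> admitted n" "mu \<in> admitted n" "w \<in> W_A n"
    and g: "\<And>i j. i \<in> {1..n + 1} \<Longrightarrow> j \<in> {1..n + 1} \<Longrightarrow> i \<noteq> j \<Longrightarrow>
      signed_coord mu i j = g j - g i + signed_coord lam (inv w i) (inv w j)"
  shows "diamond n w (X_comp n lam) = X_comp n mu"
proof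
  show "diamond n w (X_comp n lam) \<subseteq> X_comp n mu"
  proof
    fix y assume "y \<in> diamond n w (X_comp n lam)"
    then obtain x where x: "x \<in> X_comp n lam" "y = Phi_rep n w x"
      by (auto simp: diamond_def)
    obtain f where f: "\<And>i j. i \<in> {1..n + 1} \<Longrightarrow> j \<in> {1..n + 1} \<Longrightarrow> i \<noteq> j \<Longrightarrow>
        signed_coord x i j = f j - f i + of_int (signed_coord lam i j)"
      using x(1) X_comp_iff[OF assms(1)] by blast
    define h where "h i = f (inv w i) - of_int (g i)" for i
    have "signed_coord y i j = h j - h i + of_int (signed_coord mu i j)"
      if ij: "i \<in> {1..n + 1}" "j \<in> {1..n + 1}" "i \<noteq> j" for i j
    proof -
      have "inv w i \<in> {1..n + 1}" "inv w j \<in> {1..n + 1}" "inv w i \<noteq> inv w j"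
        using assms(3) ij by (simp_all only: W_A_in_iff W_A_inv_apply not_False_eq_True)
      from f[OF this] show ?thesis
        using signed_coord_Phi_rep[OF assms(3) ij, of x] g[OF ij] by (simp add: x(2) h_def)
    qed
    then show "y \<in> X_comp n mu"
      using X_comp_iff[OF assms(2)] x(2) Phi_rep_extensional by blast
  qed
  show "X_comp n mu \<subseteq> diamond n w (X_comp n lam)"
  proof
    fix y assume y: "y \<in> X_comp n mu"
    obtain f where f: "\<And>i j. i \<in> {1..n + 1} \<Longrightarrow> j \<in> {1..n + 1} \<Longrightarrow> i \<noteq> j \<Longrightarrow>
        signed_coord y i j = f j - f i + of_int (signed_coord mu i j)"
      using y X_comp_iff[OF assms(2)] by blast
    define x where "x = Phi_rep n (inv w) y"
    define h where "h i = f (w i) + of_int (g (w i))" for i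
    have "signed_coord x i j = h j - h i + of_int (signed_coord lam i j)"
      if ij: "i \<in> {1..n + 1}" "j \<in> {1..n + 1}" "i \<noteq> j" for i j
    proof -
      have w: "w i \<in> {1..n + 1}" "w j \<in> {1..n + 1}" "w i \<noteq> w j"
        using assms(3) ij by (simp_all only: W_A_in_iff W_A_inv_apply not_False_eq_True)
      from f[OF w] g[OF w] show ?thesis
        using signed_coord_Phi_rep[OF W_A_inv[OF assms(3)] ij, of y]
        by (simp add: x_def h_def inv_inv_eq[OF W_A_bij[OF assms(3)]] W_A_inv_apply[OF assms(3)])
    qed
    then have "x \<in> X_comp n lam"
      using X_comp_iff[OF assms(1)] Phi_rep_extensional unfolding x_def by blast
    moreover have "y = Phi_rep n w x"
      using Phi_rep_inv[OF assms(3)] y by (simp add: x_def X_comp_def)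
    ultimately show "y \<in> diamond n w (X_comp n lam)" by (auto simp: diamond_def)
  qed
qed

text \<open>Base point of the action: its signed coordinates \<open>0\<close> and \<open>- 1\<close>
  record the usual order of the indices.\<close>

definition zero_vector :: "nat \<Rightarrow> nat \<times> nat \<Rightarrow> int" where
  "zero_vector n = (\<lambda>_\<in>pos_roots n. 0)"

lemma zero_vector_admitted: "zero_vector n \<in> admitted n"
  by (auto simp: zero_vector_def admitted_def pos_roots_def)

lemma signed_coord_zero_vector:
  assumes "i \<in> {1..n + 1}" "j \<in> {1..n + 1}" "i \<noteq> j"
  shows "signed_coord (zero_vector n) i j = (if i < j then 0 else - 1)"
  using assms by (auto simp: signed_coord_def zero_vector_def pos_roots_def)

text \<open>The value tells whether \<open>i, j, k\<close> are in cyclic order.\<close>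

lemma signed_coord_triangle:
  assumes "lam \<in> admitted n" "{i, j, k} \<subseteq> {1..n + 1}" "i \<noteq> j" "j \<noteq> k" "i \<noteq> k"
  shows "signed_coord lam i j + signed_coord lam j k + signed_coord lam k i \<in> {- 1, - 2}"
proof -
  \<comment> \<open>This defect decides the sum: up to rotation of \<open>i, j, k\<close>, an
    increasing triple gives minus one minus the defect, a decreasing triple the defect minus
    two.\<close>
  have adm: "lam (a, c) - lam (a, b) - lam (b, c) \<in> {0, 1}"
    if "1 \<le> a" "a < b" "b < c" "c \<le> n + 1" for a b c
  proof -
    have "lam (a, b) + lam (b, c) \<le> lam (a, c)" "lam (a, c) \<le> lam (a, b) + lam (b, c) + 1"
      using assms(1) that unfolding admitted_def by blast+
    then show ?thesis by auto
  qed
  show ?thesis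
  proof (cases "i < j"; cases "j < k"; cases "i < k")
    assume "i < j" "j < k" "i < k"
    then show ?thesis using adm[of i j k] assms(2) by (auto simp: signed_coord_def)
  next
    assume "i < j" "\<not> j < k" "i < k"
    then show ?thesis using adm[of i k j] assms(2,4) by (auto simp: signed_coord_def)
  next
    assume "i < j" "\<not> j < k" "\<not> i < k"
    then show ?thesis using adm[of k i j] assms(2,4,5) by (auto simp: signed_coord_def)
  next
    assume "\<not> i < j" "j < k" "i < k"
    then show ?thesis using adm[of j i k] assms(2,3) by (auto simp: signed_coord_def)
  next
    assume "\<not> i < j" "j < k" "\<not> i < k"
    then show ?thesis using adm[of j k i] assms(2,3,5) by (auto simp: signed_coord_def)
  next
    assume "\<not> i < j" "\<not> j < k" "\<not> i < k"
    then show ?thesis using adm[of k j i] assms(2-5) by (auto simp: signed_coord_def)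
  qed (use assms(3-5) in linarith)+
qed


section \<open>The action on components\<close>

text \<open>Removing a coboundary so that row 1 vanishes leaves only the values \<open>0\<close> and
  \<open>- 1\<close>, that is, a linear order with least element 1. Its rank function is the inverse
  of the permutation sought.\<close>

lemma diamond_transitive:
  assumes lam: "lam \<in> admitted n"
  shows "\<exists>w\<in>W_A n. w 1 = 1 \<and> diamond n w (X_comp n (zero_vector n)) = X_comp n lam"
proof -
  let ?N = "{1..n + 1}"
  \<comment> \<open>Chosen so that \<open>h 1 j = 0\<close>; \<open>j = 1\<close> is treated apart
    because \<open>lam (1, 1)\<close> is not a coordinate.\<close>
  define g where "g j = (if j = 1 then 0 else lam (1, j))" for j :: nat
  define h where "h i j = signed_coord lam i j - g j + g i" for i j
  define R where "R i j \<longleftrightarrow> i \<noteq> j \<and> h i j = 0" for i j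
  have swap: "h i j + h j i = - 1" if "i \<noteq> j" for i j
    using signed_coord_swap[OF that, of lam] by (simp add: h_def)
  have h1: "h 1 j = 0" if "j \<in> ?N" "j \<noteq> 1" for j
    using that by (simp add: h_def g_def signed_coord_def)
  have h01: "h i j \<in> {0, - 1}" if "i \<in> ?N" "j \<in> ?N" "i \<noteq> j" for i j
  proof (cases "i = 1 \<or> j = 1")
    case True
    then show ?thesis using h1[of i] h1[of j] swap[of i j] that by auto
  next
    case False
    \<comment> \<open>In the triangle \<open>1, i, j\<close> the terms \<open>h 1 i = 0\<close> and
      \<open>h j 1 = - 1\<close> are known, which confines \<open>h i j\<close>.\<close>
    then show ?thesis
      using signed_coord_triangle[OF lam, of 1 i j] that swap[of 1 j] h1[of i] h1[of j]
      by (auto simp: h_def)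
  qed
  have R_trans: "R i k" if R: "R i j" "R j k" and N: "i \<in> ?N" "j \<in> ?N" "k \<in> ?N" for i j k
  proof -
    have "i \<noteq> k" using R swap[of i j] by (auto simp: R_def)
    \<comment> \<open>Since \<open>h i j = h j k = 0\<close>, the sum is just \<open>h k i\<close>;
      \<open>h01\<close> excludes \<open>- 2\<close>, and swapping gives
      \<open>h i k = 0\<close>.\<close>
    then have "h i j + h j k + h k i \<in> {- 1, - 2}"
      using signed_coord_triangle[OF lam, of i j k] R N by (auto simp: h_def R_def)
    then show ?thesis
      using R swap[of i k] h01[of k i] N \<open>i \<noteq> k\<close> by (auto simp: R_def)
  qed
  have R_irrefl: "\<not> R i i" for i by (simp add: R_def)
  have R_total: "R i j \<or> R j i" if "i \<in> ?N" "j \<in> ?N" "i \<noteq> j" for i j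
    using h01[OF that] swap[OF that(3)] that by (auto simp: R_def)
  \<comment> \<open>The rank with respect to \<open>R\<close>, counted from 1 so that it maps
    \<open>?N\<close> into itself.\<close>
  define q where "q j = (if j \<in> ?N then Suc (card {i \<in> ?N. R i j}) else j)" for j
  have mono: "q i < q j" if "R i j" "i \<in> ?N" "j \<in> ?N" for i j
  proof -
    have "{k \<in> ?N. R k i} \<subset> {k \<in> ?N. R k j}"
      using that R_trans R_irrefl by blast
    then have "card {k \<in> ?N. R k i} < card {k \<in> ?N. R k j}" by (intro psubset_card_mono) auto
    then show ?thesis using that by (simp add: q_def)
  qed
  have "q ` ?N \<subseteq> ?N"
  proof
    fix a assume "a \<in> q ` ?N"
    then obtain j where j: "j \<in> ?N" "a = Suc (card {i \<in> ?N. R i j})" by (auto simp: q_def)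
    have "{i \<in> ?N. R i j} \<subset> ?N" using j(1) R_irrefl by blast
    then have "card {i \<in> ?N. R i j} < card ?N" by (intro psubset_card_mono) auto
    then show "a \<in> ?N" using j(2) by simp
  qed
  moreover have "inj_on q ?N"
    by (rule inj_onI) (metis R_total mono less_irrefl)
  ultimately have "bij_betw q ?N ?N"
    by (simp add: bij_betw_def endo_inj_surj)
  then have "q permutes ?N"
    by (rule bij_imp_permutes) (auto simp: q_def)
  then have q: "q \<in> W_A n" by (simp add: W_A_def)
  have "\<not> R i 1" if "i \<in> ?N" for i
    using h1[of i] swap[of i 1] that by (auto simp: R_def)
  then have "{i \<in> ?N. R i 1} = {}" by blast
  then have "q 1 = 1" by (simp add: q_def)
  then have "inv q 1 = 1" by (metis W_A_inv_apply(2) q)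
  \<comment> \<open>The criterion compares along the inverse of the acting permutation, so
    \<open>inv q\<close> has to act for the ranks \<open>q i\<close> and \<open>q j\<close> to
    appear.\<close>
  moreover have "diamond n (inv q) (X_comp n (zero_vector n)) = X_comp n lam"
  proof (rule diamond_X_comp_eqI[OF zero_vector_admitted lam W_A_inv[OF q]])
    fix i j assume ij: "i \<in> ?N" "j \<in> ?N" "i \<noteq> j"
    then have qij: "q i \<in> ?N" "q j \<in> ?N" "q i \<noteq> q j"
      using q by (simp_all only: W_A_in_iff W_A_inv_apply not_False_eq_True)
    have "h i j = (if q i < q j then 0 else - 1)"
      using R_total[OF ij] mono[of i j] mono[of j i] h01[OF ij] swap[OF ij(3)] ij
      by (auto simp: R_def)
    then show "signed_coord lam i j = g j - g i
        + signed_coord (zero_vector n) (inv (inv q) i) (inv (inv q) j)"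
      using signed_coord_zero_vector[OF qij]
      by (simp add: inv_inv_eq[OF W_A_bij[OF q]] h_def)
  qed
  ultimately show ?thesis using W_A_inv[OF q] by blast
qed

text \<open>Testing on the origin suffices: its image stays in the component only if the order
  pulled back along \<open>inv v\<close> differs from the usual one by a coboundary. As 1 is least
  in both orders, the potential is constant, so \<open>inv v\<close> is increasing.\<close>

lemma diamond_stabilizer:
  assumes v: "v \<in> W_A n" "v 1 = 1"
    and "diamond n v (X_comp n (zero_vector n)) = X_comp n (zero_vector n)"
  shows "v = id"
proof -
  let ?N = "{1..n + 1}"
  have v': "v permutes ?N" using v by (simp add: W_A_def)
  define x :: "nat \<times> nat \<Rightarrow> real" where "x = (\<lambda>_\<in>pos_roots n. 0)"
  have "x \<in> X_comp n (zero_vector n)"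
    by (auto simp: X_comp_def x_def zero_vector_def pos_roots_def intro!: sum.neutral)
  then have "Phi_rep n v x \<in> X_comp n (zero_vector n)"
    using assms(3) by (auto simp: diamond_def)
  then obtain f where f: "\<And>i j. i \<in> ?N \<Longrightarrow> j \<in> ?N \<Longrightarrow> i \<noteq> j \<Longrightarrow>
      signed_coord (Phi_rep n v x) i j = f j - f i + of_int (signed_coord (zero_vector n) i j)"
    using X_comp_iff[OF zero_vector_admitted] by blast
  have x: "signed_coord x i j = (if i < j then 0 else - 1)" if "i \<in> ?N" "j \<in> ?N" "i \<noteq> j" for i j
    using that by (auto simp: signed_coord_def x_def pos_roots_def)
  have inv1: "inv v 1 = 1" by (metis W_A_inv_apply(2) v)
  have inv: "inv v i \<in> ?N" if "i \<in> ?N" for i using that W_A_in_iff[OF v(1)] by blast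
  have eq: "(if inv v i < inv v j then 0 else - 1) = f j - f i + (if i < j then 0 else - 1 :: real)"
    if ij: "i \<in> ?N" "j \<in> ?N" "i \<noteq> j" for i j
    using f[OF ij] signed_coord_Phi_rep[OF v(1) ij, of x] x[OF inv inv, OF ij(1,2)] ij
      signed_coord_zero_vector[OF ij] by (simp add: W_A_inv_apply[OF v(1)] split: if_splits)
  have "f j = f 1" if "j \<in> ?N" "j \<noteq> 1" for j
  proof -
    have "inv v j \<noteq> 1" using that inv1 W_A_inv_apply(3)[OF v(1)] by metis
    then show ?thesis using eq[of 1 j] that inv1 inv[OF that(1)] by (simp split: if_splits)
  qed
  then have f1: "f j = f 1" if "j \<in> ?N" for j using that by blast
  have mono: "inv v i < inv v j" if ij: "i \<in> ?N" "j \<in> ?N" "i < j" for i j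
    using eq[OF ij(1,2)] ij f1[of i] f1[of j] by (simp split: if_splits)
  \<comment> \<open>An increasing self-map of \<open>?N\<close> never falls below the identity, and
    a permutation with that property is the identity.\<close>
  have "\<forall>i\<in>?N. i \<le> inv v i"
  proof (intro ballI)
    fix i assume "i \<in> ?N"
    then show "i \<le> inv v i"
    proof (induction i)
      case (Suc i)
      then show ?case using mono[of i "Suc i"] inv[of "Suc i"] by (cases "i = 0") auto
    qed simp
  qed
  then have "inv v = id"
    by (intro permutes_natset_ge[OF permutes_inv[OF v']])
  then show "v = id" by (metis inv_id inv_inv_eq W_A_bij v(1))
qed

lemma diamond_zero_vector_in_H0_shi:
  assumes w: "w \<in> W_A n"
  shows "diamond n w (X_comp n (zero_vector n)) \<in> H0_shi n"
proof -
  define q where "q = inv w"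
  define d :: "nat \<Rightarrow> nat \<Rightarrow> int" where "d i j = (if q i < q j then 0 else - 1)" for i j
  define g where "g j = - (\<Sum>r = 1..<j. d r (Suc r))" for j
  define lam where "lam = (\<lambda>(i, j)\<in>pos_roots n. g j - g i + d i j)"
  have lam: "lam (i, j) = g j - g i + d i j" if "1 \<le> i" "i < j" "j \<le> n + 1" for i j
    using that by (simp add: lam_def pos_roots_def)
  have adm: "lam \<in> admitted n"
    unfolding admitted_def
  proof (intro CollectI conjI ballI allI impI)
    show "lam \<in> extensional (pos_roots n)" by (simp add: lam_def)
    show "lam (i, i + 1) = 0" if "i \<in> {1..n}" for i
      using that lam[of i "i + 1"] by (simp add: g_def)
    fix i j k assume "1 \<le> i \<and> i < j \<and> j < k \<and> k \<le> n + 1"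
    then have "lam (i, j) = g j - g i + d i j" "lam (j, k) = g k - g j + d j k"
      "lam (i, k) = g k - g i + d i k"
      by (intro lam; simp)+
    then show "lam (i, j) + lam (j, k) \<le> lam (i, k)" "lam (i, k) \<le> lam (i, j) + lam (j, k) + 1"
      by (auto simp: d_def)
  qed
  have "diamond n w (X_comp n (zero_vector n)) = X_comp n lam"
  proof (rule diamond_X_comp_eqI[OF zero_vector_admitted adm w])
    fix i j assume ij: "i \<in> {1..n + 1}" "j \<in> {1..n + 1}" "i \<noteq> j"
    then have "q i \<in> {1..n + 1}" "q j \<in> {1..n + 1}" "q i \<noteq> q j"
      using w by (simp_all only: q_def W_A_in_iff W_A_inv_apply not_False_eq_True)
    from signed_coord_zero_vector[OF this]
    have "signed_coord (zero_vector n) (q i) (q j) = d i j" by (simp add: d_def)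
    then show "signed_coord lam i j = g j - g i + signed_coord (zero_vector n) (inv w i) (inv w j)"
      using ij lam[of i j] lam[of j i] \<open>q i \<noteq> q j\<close> by (auto simp: signed_coord_def d_def q_def)
  qed
  then show ?thesis using adm by (simp add: H0_shi_eq)
qed


section \<open>The standard circular permutation\<close>

definition std_cycle :: "nat \<Rightarrow> nat \<Rightarrow> nat" where
  "std_cycle n = cycle_of_list [1..<n + 2]"

lemma std_cycle_W_A: "std_cycle n \<in> W_A n"
proof -
  have "set [1..<n + 2] = {1..n + 1}" by auto
  then show ?thesis using cycle_permutes[of "[1..<n + 2]"] by (simp add: std_cycle_def W_A_def)
qed

text \<open>All three are instances of one fact: the \<open>m\<close>-th power of a cycle shifts its
  list by \<open>m\<close> places. List index \<open>k\<close> holds the entry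
  \<open>k + 1\<close>.\<close>

lemma std_cycle_pow: "m \<le> n \<Longrightarrow> (std_cycle n ^^ m) 1 = m + 1"
  and std_cycle_Suc: "1 \<le> i \<Longrightarrow> i \<le> n \<Longrightarrow> std_cycle n i = Suc i"
  and std_cycle_last: "std_cycle n (n + 1) = 1"
proof -
  let ?l = "[1..<n + 2]"
  have rot: "(std_cycle n ^^ m) (?l ! k) = ?l ! ((k + m) mod (n + 1))" if "k \<le> n" for m k
  proof -
    have "(std_cycle n ^^ m) (?l ! k) = map (std_cycle n ^^ m) ?l ! k"
      using that by (simp del: upt_Suc)
    also have "\<dots> = rotate m ?l ! k"
      unfolding std_cycle_def by (subst cyclic_rotation) simp_all
    finally show ?thesis using that by (simp add: nth_rotate add.commute del: upt_Suc)
  qed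
  show "m \<le> n \<Longrightarrow> (std_cycle n ^^ m) 1 = m + 1"
    using rot[of 0 m] by (simp del: upt_Suc)
  show "1 \<le> i \<Longrightarrow> i \<le> n \<Longrightarrow> std_cycle n i = Suc i"
    using rot[of "i - 1" 1] by (simp del: upt_Suc)
  show "std_cycle n (n + 1) = 1"
    using rot[of n 1] by (simp del: upt_Suc)
qed

lemma inv_std_cycle:
  assumes "i \<in> {1..n + 1}"
  shows "inv (std_cycle n) i = (if i = 1 then n + 1 else i - 1)"
proof -
  have "std_cycle n (if i = 1 then n + 1 else i - 1) = i"
    using assms std_cycle_Suc[of "i - 1" n] std_cycle_last[of n] by auto
  from arg_cong[OF this, of "inv (std_cycle n)"] show ?thesis
    by (simp only: W_A_inv_apply(2)[OF std_cycle_W_A])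
qed

text \<open>The cycle moves 1 from the bottom of the order to the top. This changes the linear order
  but not the cyclic one, so it amounts to a coboundary.\<close>

lemma diamond_std_cycle:
  "diamond n (std_cycle n) (X_comp n (zero_vector n)) = X_comp n (zero_vector n)"
proof (rule diamond_X_comp_eqI[OF zero_vector_admitted zero_vector_admitted std_cycle_W_A])
  fix i j assume ij: "i \<in> {1..n + 1}" "j \<in> {1..n + 1}" "i \<noteq> j"
  \<comment> \<open>Supported at 1, since exactly the comparisons with 1 are reversed.\<close>
  let ?g = "\<lambda>i. if i = 1 then - 1 else 0 :: int"
  have "inv (std_cycle n) i \<in> {1..n + 1}" "inv (std_cycle n) j \<in> {1..n + 1}"
    "inv (std_cycle n) i \<noteq> inv (std_cycle n) j"
    using ij by (simp_all only: W_A_in_iff[OF std_cycle_W_A] W_A_inv_apply[OF std_cycle_W_A] not_False_eq_True)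
  from signed_coord_zero_vector[OF this] signed_coord_zero_vector[OF ij]
  show "signed_coord (zero_vector n) i j = ?g j - ?g i
      + signed_coord (zero_vector n) (inv (std_cycle n) i) (inv (std_cycle n) j)"
    using ij by (auto simp: inv_std_cycle)
qed

lemma std_cycle_pow_W_A: "std_cycle n ^^ m \<in> W_A n"
  using permutes_funpow std_cycle_W_A[of n] by (simp add: W_A_def)

lemma diamond_std_cycle_pow:
  "diamond n (std_cycle n ^^ m) (X_comp n (zero_vector n)) = X_comp n (zero_vector n)"
proof (induction m)
  case 0
  have "Phi_rep n id x = x" if "x \<in> X_comp n (zero_vector n)" for x
    using that by (intro extensional_eq_signed_coord[OF Phi_rep_extensional])
      (auto simp: X_comp_def signed_coord_def Phi_rep_def pos_roots_def)
  then show ?case by (simp add: diamond_def id_def[symmetric])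
next
  case (Suc m)
  have "std_cycle n ^^ Suc m = std_cycle n \<circ> (std_cycle n ^^ m)" by simp
  then show ?case
    using Suc by (simp only: diamond_comp[OF std_cycle_W_A std_cycle_pow_W_A] diamond_std_cycle)
qed

text \<open>Conjugating by \<open>w\<close> relabels the list of a cycle by \<open>w\<close>, and
  every arrangement of all indices is a relabelling of \<open>[1..<n + 2]\<close>.\<close>

lemma circular_perms_eq:
  "circular_perms n = (\<lambda>w. w \<circ> std_cycle n \<circ> inv w) ` W_A n"
proof (intro equalityI subsetI)
  let ?l = "[1..<n + 2]"
  fix c assume "c \<in> circular_perms n"
  then obtain cs where cs: "distinct cs" "set cs \<subseteq> {1..n + 1}" "length cs = n + 1" "c = cycle_of_list cs"
    by (auto simp: circular_perms_def)
  have set_cs: "set cs = {1..n + 1}"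
    using cs distinct_card[OF cs(1)] by (intro card_subset_eq) auto
  define w where "w i = (if i \<in> {1..n + 1} then cs ! (i - 1) else i)" for i
  have map: "map w ?l = cs"
    using cs(3) by (intro nth_equalityI) (auto simp: w_def simp del: upt_Suc)
  have "set ?l = {1..n + 1}" by auto
  then have "w ` {1..n + 1} = {1..n + 1}"
    using map set_cs by (metis list.set_map)
  then have "bij_betw w {1..n + 1} {1..n + 1}"
    by (simp add: bij_betw_def finite_surj_inj)
  then have w: "w \<in> W_A n"
    unfolding W_A_def by (auto intro!: bij_imp_permutes simp: w_def)
  then have "c = w \<circ> std_cycle n \<circ> inv w"
    using conjugation_of_cycle[of ?l w] map W_A_bij[OF w] cs(4) by (simp add: std_cycle_def del: upt_Suc)
  then show "c \<in> (\<lambda>w. w \<circ> std_cycle n \<circ> inv w) ` W_A n" using w by blast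
next
  let ?l = "[1..<n + 2]"
  fix c assume "c \<in> (\<lambda>w. w \<circ> std_cycle n \<circ> inv w) ` W_A n"
  then obtain w where w: "w \<in> W_A n" "c = w \<circ> std_cycle n \<circ> inv w" by blast
  have c: "c = cycle_of_list (map w ?l)"
    using conjugation_of_cycle[of ?l w] w W_A_bij[OF w(1)] by (simp add: std_cycle_def del: upt_Suc)
  have "distinct (map w ?l)"
    using W_A_bij[OF w(1)] by (auto simp: distinct_map bij_def intro: inj_on_subset simp del: upt_Suc)
  moreover have "set (map w ?l) \<subseteq> {1..n + 1}"
    using W_A_in_iff(1)[OF w(1)] by (simp only: list.set_map set_upt image_subset_iff) simp
  moreover have "c \<in> W_A n"
    unfolding w(2) by (rule W_A_comp[OF W_A_comp[OF w(1) std_cycle_W_A] W_A_inv[OF w(1)]])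
  ultimately show "c \<in> circular_perms n"
    using c by (auto simp: circular_perms_def simp del: upt_Suc intro!: exI[of _ "map w ?l"])
qed


section \<open>The bijection\<close>

text \<open>Representatives of the left cosets of the powers of \<open>std_cycle n\<close>; both
  parametrisations below are constant on these cosets.\<close>

definition pointed_perms :: "nat \<Rightarrow> (nat \<Rightarrow> nat) set" where
  "pointed_perms n = {w \<in> W_A n. w 1 = 1}"

lemma card_pointed_perms: "card (pointed_perms n) = fact n"
proof -
  have "pointed_perms n = {w. w permutes {2..n + 1}}"
  proof (intro equalityI subsetI)
    fix w assume w: "w \<in> pointed_perms n"
    have "w permutes {2..n + 1}"
    proof (rule permutes_superset[of _ "{1..n + 1}"])
      fix x assume "x \<in> {1..n + 1} - {2..n + 1}"
      then have "x = 1" by auto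
      then show "w x = x" using w by (simp add: pointed_perms_def)
    qed (use w in \<open>simp add: pointed_perms_def W_A_def\<close>)
    then show "w \<in> {w. w permutes {2..n + 1}}" by simp
  next
    fix w assume "w \<in> {w. w permutes {2..n + 1}}"
    then have w: "w permutes {2..n + 1}" by simp
    have "w permutes {1..n + 1}" by (rule permutes_subset[OF w]) auto
    moreover have "w 1 = 1" by (rule permutes_not_in[OF w]) auto
    ultimately show "w \<in> pointed_perms n" by (simp add: pointed_perms_def W_A_def)
  qed
  then show ?thesis using card_permutations[of "{2..n + 1}" n] by simp
qed

text \<open>A power of the cycle carries 1 to \<open>inv w 1\<close>, and \<open>w\<close> then
  brings it back to 1.\<close>

lemma W_A_pointed:
  assumes "w \<in> W_A n"
  shows "\<exists>m. w \<circ> std_cycle n ^^ m \<in> pointed_perms n"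
proof (intro exI)
  have "inv w 1 \<in> {1..n + 1}" using W_A_in_iff[OF assms] by simp
  then have "(std_cycle n ^^ (inv w 1 - 1)) 1 = inv w 1"
    using std_cycle_pow[of "inv w 1 - 1" n] by auto
  then show "w \<circ> std_cycle n ^^ (inv w 1 - 1) \<in> pointed_perms n"
    using W_A_comp[OF assms std_cycle_pow_W_A] W_A_inv_apply[OF assms]
    by (simp add: pointed_perms_def)
qed

lemma conj_std_cycle_pow:
  assumes "w \<in> W_A n"
  shows "(w \<circ> std_cycle n ^^ m) \<circ> std_cycle n \<circ> inv (w \<circ> std_cycle n ^^ m) = w \<circ> std_cycle n \<circ> inv w"
proof -
  let ?p = "std_cycle n ^^ m"
  have "inv (w \<circ> ?p) = inv ?p \<circ> inv w"
    using W_A_bij[OF assms] W_A_bij[OF std_cycle_pow_W_A] by (intro o_inv_distrib) auto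
  moreover have "?p (std_cycle n (inv ?p i)) = std_cycle n i" for i
    by (metis W_A_inv_apply(1) funpow_swap1 std_cycle_pow_W_A)
  ultimately show ?thesis by (simp add: fun_eq_iff)
qed

text \<open>If two permutations fixing 1 give equal conjugates, agreement at \<open>i\<close> passes
  to the next index of the cycle, hence from 1 to all indices. For surjectivity, any conjugator is
  corrected by a power of the cycle.\<close>

lemma bij_betw_pointed_circular:
  "bij_betw (\<lambda>w. w \<circ> std_cycle n \<circ> inv w) (pointed_perms n) (circular_perms n)"
proof (rule bij_betw_imageI)
  show "inj_on (\<lambda>w. w \<circ> std_cycle n \<circ> inv w) (pointed_perms n)"
  proof (rule inj_onI)
    fix v w assume v: "v \<in> pointed_perms n" and w: "w \<in> pointed_perms n"
      and eq: "v \<circ> std_cycle n \<circ> inv v = w \<circ> std_cycle n \<circ> inv w"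
    have W: "v \<in> W_A n" "w \<in> W_A n" using v w by (auto simp: pointed_perms_def)
    have step: "v (std_cycle n i) = w (std_cycle n i)" if "v i = w i" for i
    proof -
      have "inv v (w i) = i"
        by (simp only: that[symmetric] W_A_inv_apply(2)[OF W(1)])
      moreover have "inv w (w i) = i" by (rule W_A_inv_apply(2)[OF W(2)])
      ultimately show ?thesis using fun_cong[OF eq, of "w i"] by simp
    qed
    have pow: "v ((std_cycle n ^^ m) 1) = w ((std_cycle n ^^ m) 1)" for m
      by (induction m) (use v w step in \<open>auto simp: pointed_perms_def\<close>)
    show "v = w"
    proof
      fix i show "v i = w i"
      proof (cases "i \<in> {1..n + 1}")
        case True
        then show ?thesis using pow[of "i - 1"] std_cycle_pow[of "i - 1" n] by auto
      next
        case False
        then show ?thesis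
          using W permutes_not_in[of v "{1..n + 1}" i] permutes_not_in[of w "{1..n + 1}" i]
          by (simp add: W_A_def)
      qed
    qed
  qed
  show "(\<lambda>w. w \<circ> std_cycle n \<circ> inv w) ` pointed_perms n = circular_perms n"
  proof
    show "(\<lambda>w. w \<circ> std_cycle n \<circ> inv w) ` pointed_perms n \<subseteq> circular_perms n"
      unfolding circular_perms_eq by (auto simp: pointed_perms_def)
    show "circular_perms n \<subseteq> (\<lambda>w. w \<circ> std_cycle n \<circ> inv w) ` pointed_perms n"
      unfolding circular_perms_eq
    proof
      fix c assume "c \<in> (\<lambda>w. w \<circ> std_cycle n \<circ> inv w) ` W_A n"
      then obtain w where w: "w \<in> W_A n" "c = w \<circ> std_cycle n \<circ> inv w" by blast
      obtain m where "w \<circ> std_cycle n ^^ m \<in> pointed_perms n" using W_A_pointed[OF w(1)] by blast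
      moreover have "c = (w \<circ> std_cycle n ^^ m) \<circ> std_cycle n \<circ> inv (w \<circ> std_cycle n ^^ m)"
        by (simp only: w(2) conj_std_cycle_pow[OF w(1)])
      ultimately show "c \<in> (\<lambda>w. w \<circ> std_cycle n \<circ> inv w) ` pointed_perms n"
        by (intro image_eqI[of _ _ "w \<circ> std_cycle n ^^ m"])
    qed
  qed
qed

lemma bij_betw_pointed_H0_shi:
  "bij_betw (\<lambda>w. diamond n w (X_comp n (zero_vector n))) (pointed_perms n) (H0_shi n)"
proof (rule bij_betw_imageI)
  let ?X = "X_comp n (zero_vector n)"
  show "inj_on (\<lambda>w. diamond n w ?X) (pointed_perms n)"
  proof (rule inj_onI)
    fix v w assume v: "v \<in> pointed_perms n" and w: "w \<in> pointed_perms n"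
      and eq: "diamond n v ?X = diamond n w ?X"
    have W: "v \<in> W_A n" "w \<in> W_A n" using v w by (auto simp: pointed_perms_def)
    have "diamond n (inv w \<circ> v) ?X = diamond n (inv w \<circ> w) ?X"
      by (simp add: diamond_comp W W_A_inv eq)
    \<comment> \<open>Writing the identity as a zeroth power lets
      \<open>diamond_std_cycle_pow\<close> show that it acts trivially.\<close>
    also have "inv w \<circ> w = std_cycle n ^^ 0" using W_A_inv_apply[OF W(2)] by auto
    also have "diamond n \<dots> ?X = ?X" by (rule diamond_std_cycle_pow)
    finally have "diamond n (inv w \<circ> v) ?X = ?X" .
    moreover have "(inv w \<circ> v) 1 = 1"
      using v w W_A_inv_apply(2)[OF W(2), of 1] by (simp add: pointed_perms_def)
    ultimately have "inv w \<circ> v = id"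
      by (intro diamond_stabilizer[OF W_A_comp[OF W_A_inv[OF W(2)] W(1)]])
    then have "inv w (v i) = i" for i by (simp add: fun_eq_iff)
    then have "w i = v i" for i using W_A_inv_apply(1)[OF W(2), of "v i"] by simp
    then show "v = w" by (simp add: fun_eq_iff)
  qed
  show "(\<lambda>w. diamond n w ?X) ` pointed_perms n = H0_shi n"
  proof
    show "H0_shi n \<subseteq> (\<lambda>w. diamond n w ?X) ` pointed_perms n"
      unfolding H0_shi_eq using diamond_transitive by (fastforce simp: pointed_perms_def)
    show "(\<lambda>w. diamond n w ?X) ` pointed_perms n \<subseteq> H0_shi n"
      using diamond_zero_vector_in_H0_shi by (auto simp: pointed_perms_def)
  qed
qed

theorem theorem1p3:
  fixes n :: nat
  assumes "n \<ge> 1"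
  shows "(\<exists>\<Psi>. bij_betw \<Psi> (circular_perms n) (H0_shi n) \<and>
             (\<forall>\<sigma> \<in> W_A n. \<forall>c \<in> circular_perms n.
                \<Psi> (\<sigma> \<circ> c \<circ> inv \<sigma>) = diamond n \<sigma> (\<Psi> c)))
         \<and> card (H0_shi n) = fact n"
proof (intro conjI exI ballI)
  let ?A = "\<lambda>w. w \<circ> std_cycle n \<circ> inv w"
  let ?B = "\<lambda>w. diamond n w (X_comp n (zero_vector n))"
  let ?\<Psi> = "?B \<circ> inv_into (pointed_perms n) ?A"
  note A = bij_betw_pointed_circular[of n] and B = bij_betw_pointed_H0_shi[of n]
  show "bij_betw ?\<Psi> (circular_perms n) (H0_shi n)"
    by (rule bij_betw_trans[OF bij_betw_inv_into[OF A] B])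
  show "card (H0_shi n) = fact n"
    using bij_betw_same_card[OF B] card_pointed_perms by simp
  \<comment> \<open>Holds for every \<open>w\<close>, not only for those fixing 1, as neither side
    changes when \<open>w\<close> is multiplied on the right by a power of the cycle. Equivariance
    then follows by replacing \<open>w\<close> with \<open>\<sigma> \<circ> w\<close>.\<close>
  have \<Psi>: "?\<Psi> (?A w) = ?B w" if w: "w \<in> W_A n" for w
  proof -
    obtain m where m: "w \<circ> std_cycle n ^^ m \<in> pointed_perms n" using W_A_pointed[OF w] by blast
    have "?\<Psi> (?A w) = ?\<Psi> (?A (w \<circ> std_cycle n ^^ m))"
      by (simp only: conj_std_cycle_pow[OF w])
    also have "\<dots> = ?B (w \<circ> std_cycle n ^^ m)"
      using bij_betw_inv_into_left[OF A m] by simp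
    also have "\<dots> = ?B w"
      by (simp only: diamond_comp[OF w std_cycle_pow_W_A] diamond_std_cycle_pow)
    finally show ?thesis .
  qed
  fix \<sigma> c assume \<sigma>: "\<sigma> \<in> W_A n" and "c \<in> circular_perms n"
  then obtain w where w: "w \<in> W_A n" "c = ?A w" by (auto simp: circular_perms_eq)
  have "inv (\<sigma> \<circ> w) = inv w \<circ> inv \<sigma>"
    using W_A_bij \<sigma> w(1) by (intro o_inv_distrib) auto
  then have "\<sigma> \<circ> c \<circ> inv \<sigma> = ?A (\<sigma> \<circ> w)" by (simp add: w(2) o_assoc)
  then show "?\<Psi> (\<sigma> \<circ> c \<circ> inv \<sigma>) = diamond n \<sigma> (?\<Psi> c)"
    using \<Psi> W_A_comp[OF \<sigma> w(1)] w diamond_comp[OF \<sigma> w(1)] by simp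
qed

end
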